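(* Let $k$ be a field and let $A$ be a $k$-algebra that is a domain. Then $\mathrm{Ld}^*(A)\le \mathrm{GKdim}(A)$.
   Context: A subframe of $A$ is a finite-dimensional $k$-subspace of $A$ containing $1$. For a subframe $V$ of $A$, $\mathrm{VDI}^*(V)\in[0,\infty]$ is the supremum of all real $d>0$ for which there is a constant $C>0$ with $\max(\dim_k(VW),\dim_k(WV))\ge \dim_k(W)+C\,(\dim_k W)^{(d-1)/d}$ for every subframe $W$ of $A$ (and $0$ if there is no such $d$). The strong lower transcendence degree is $\mathrm{Ld}^*(A)=\sup_V\mathrm{VDI}^*(V)$ over all subframes $V$ of $A$. Here $VW$ is the $k$-span of the products $vw$. For a finitely generated $k$-algebra $B$, $\mathrm{GKdim}(B)=\limsup_{n\to\infty}\frac{\log \dim_k V^n}{\log n}$ for any finite-dimensional subspace $V\ni 1$ generating $B$; in general, $\mathrm{GKdim}(A)$ is the supremum of $\mathrm{GKdim}(B)$ over the finitely generated subalgebras $B$ of $A$. *)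

theory Defs
  imports Complex_Main "HOL-Library.Extended_Nonnegative_Real"
begin

text \<open>
  Associative unital algebras over a field, not necessarily commutative. As the class \<open>ring_1\<close>
  contains \<open>0 \<noteq> 1\<close>, the algebra is never zero; a domain is an algebra on a type of class
  \<open>ring_1_no_zero_divisors\<close>.
\<close>

locale k_algebra = vector_space scale
  for scale :: "'k::field \<Rightarrow> 'a::ring_1 \<Rightarrow> 'a" (infixr "*s" 75) +
  assumes scale_mult_left: "(c *s x) * y = c *s (x * y)"
    and scale_mult_right: "x * (c *s y) = c *s (x * y)"
begin

definition subframe :: "'a set \<Rightarrow> bool" where
  "subframe V \<longleftrightarrow> subspace V \<and> (\<exists>B. finite B \<and> span B = V) \<and> 1 \<in> V"

definition prod_space :: "'a set \<Rightarrow> 'a set \<Rightarrow> 'a set" where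
  "prod_space V W = span {v * w | v w. v \<in> V \<and> w \<in> W}"

primrec power_space :: "'a set \<Rightarrow> nat \<Rightarrow> 'a set" where
  "power_space V 0 = span {1}"
| "power_space V (Suc n) = prod_space V (power_space V n)"

text \<open>
  The value lies in \<open>[0,\<infinity>]\<close>, where the supremum of the empty set is \<open>0\<close>.
\<close>

definition VDI_star :: "'a set \<Rightarrow> ennreal" where
  "VDI_star V = Sup {ennreal d | d. d > 0 \<and>
     (\<exists>C>0. \<forall>W. subframe W \<longrightarrow>
        real (max (dim (prod_space V W)) (dim (prod_space W V)))
          \<ge> real (dim W) + C * real (dim W) powr ((d - 1) / d))}"

definition Ld_star :: ennreal where
  "Ld_star = (SUP V \<in> {V. subframe V}. VDI_star V)"

definition subalgebra :: "'a set \<Rightarrow> bool" where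
  "subalgebra B \<longleftrightarrow> subspace B \<and> 1 \<in> B \<and> (\<forall>x\<in>B. \<forall>y\<in>B. x * y \<in> B)"

definition fin_gen_subalgebra :: "'a set \<Rightarrow> bool" where
  "fin_gen_subalgebra B \<longleftrightarrow> (\<exists>S. finite S \<and> subalgebra hull S = B)"

text \<open>
  For a subframe \<open>V\<close> and \<open>n \<ge> 2\<close> the quotient is a nonnegative real, so the coercion
  to \<^typ>\<open>ennreal\<close> truncates nothing.
\<close>

definition growth :: "'a set \<Rightarrow> ennreal" where
  "growth V = limsup (\<lambda>n. ennreal (ln (real (dim (power_space V n))) / ln (real n)))"

text \<open>
  The generating subframe is chosen arbitrarily; by the lemmas \<open>ex_generating_subframe\<close> and
  \<open>GKdim_fg_eq\<close> below, one exists and the value does not depend on the choice.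
\<close>

definition GKdim_fg :: "'a set \<Rightarrow> ennreal" where
  "GKdim_fg B = growth (SOME V. subframe V \<and> subalgebra hull V = B)"

definition GKdim :: ennreal where
  "GKdim = (SUP B \<in> {B. fin_gen_subalgebra B}. GKdim_fg B)"


lemma subalgebra_hull: "subalgebra (subalgebra hull S)"
  by (rule hull_in) (auto simp: subalgebra_def subspace_def)

lemma ex_generating_subframe:
  assumes "fin_gen_subalgebra B"
  shows "\<exists>V. subframe V \<and> subalgebra hull V = B"
proof -
  obtain S where S: "finite S" "subalgebra hull S = B"
    using assms by (auto simp: fin_gen_subalgebra_def)
  let ?V = "span (insert 1 S)"
  have B: "subalgebra B" using S(2) subalgebra_hull by blast
  have "subframe ?V"
    unfolding subframe_def using S(1) by (auto intro: span_base)
  moreover have "subalgebra hull ?V = B"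
  proof (rule hull_unique)
    have "insert 1 S \<subseteq> B"
      using S(2) hull_subset[of S subalgebra] B by (auto simp: subalgebra_def)
    then show "?V \<subseteq> B"
      using B by (intro span_minimal) (auto simp: subalgebra_def)
    show "subalgebra B" by (rule B)
    fix T assume T: "?V \<subseteq> T" "subalgebra T"
    have "S \<subseteq> T" using T(1) span_superset[of "insert 1 S"] by blast
    then show "B \<subseteq> T" using S(2) T(2) hull_minimal by blast
  qed
  ultimately show ?thesis by blast
qed

lemma subspace_prod_space [simp]: "subspace (prod_space V W)"
  by (simp add: prod_space_def)

lemma subspace_power_space [simp]: "subspace (power_space V n)"
  by (cases n) simp_all

lemma prod_space_mem: "v \<in> V \<Longrightarrow> w \<in> W \<Longrightarrow> v * w \<in> prod_space V W"
  unfolding prod_space_def by (rule span_base) auto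

lemma prod_space_subset:
  assumes "subspace U" "\<And>v w. v \<in> V \<Longrightarrow> w \<in> W \<Longrightarrow> v * w \<in> U"
  shows "prod_space V W \<subseteq> U"
  unfolding prod_space_def using assms by (intro span_minimal) auto

lemma prod_space_mono: "V \<subseteq> V' \<Longrightarrow> W \<subseteq> W' \<Longrightarrow> prod_space V W \<subseteq> prod_space V' W'"
  by (rule prod_space_subset) (auto intro: prod_space_mem)

lemma subspace_left_mult: "subspace U \<Longrightarrow> subspace {x. x * z \<in> U}"
  by (auto simp: subspace_def distrib_right scale_mult_left)

lemma subspace_right_mult: "subspace U \<Longrightarrow> subspace {x. z * x \<in> U}"
  by (auto simp: subspace_def distrib_left scale_mult_right)

lemma power_space_mult:
  assumes "x \<in> power_space V m" "y \<in> power_space V n"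
  shows "x * y \<in> power_space V (m + n)"
  using assms(1)
proof (induction m arbitrary: x)
  case 0
  have "span {1} \<subseteq> {x. x * y \<in> power_space V n}"
    using assms(2) by (intro span_minimal subspace_left_mult) auto
  then show ?case using 0 by auto
next
  case (Suc m)
  have "prod_space V (power_space V m) \<subseteq> {x. x * y \<in> power_space V (Suc m + n)}"
    using Suc.IH by (intro prod_space_subset subspace_left_mult)
      (auto simp: mult.assoc intro: prod_space_mem)
  then show ?case using Suc.prems by auto
qed

lemma one_in_power_space: "1 \<in> V \<Longrightarrow> 1 \<in> power_space V n"
proof (induction n)
  case 0
  show ?case by (auto intro: span_base)
next
  case (Suc n)
  then show ?case using prod_space_mem[of 1 V 1 "power_space V n"] by simp
qed

lemma power_space_mono:
  assumes "1 \<in> V" "m \<le> n"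
  shows "power_space V m \<subseteq> power_space V n"
proof
  fix x assume "x \<in> power_space V m"
  then have "x * 1 \<in> power_space V (m + (n - m))"
    by (intro power_space_mult one_in_power_space assms)
  then show "x \<in> power_space V n" using assms(2) by simp
qed

lemma finite_dim_prod_space:
  assumes "finite A" "finite B"
  shows "prod_space (span A) (span B) = span {a * b | a b. a \<in> A \<and> b \<in> B}" (is "_ = ?R")
proof
  have 1: "a * y \<in> ?R" if "a \<in> A" "y \<in> span B" for a y
  proof -
    have "span B \<subseteq> {y. a * y \<in> ?R}"
      using that by (intro span_minimal subspace_right_mult) (auto intro: span_base)
    then show ?thesis using that by auto
  qed
  show "prod_space (span A) (span B) \<subseteq> ?R"
  proof (rule prod_space_subset)
    fix x y assume x: "x \<in> span A" and y: "y \<in> span B"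
    have "span A \<subseteq> {x. x * y \<in> ?R}"
      using 1 y by (intro span_minimal subspace_left_mult) auto
    then show "x * y \<in> ?R" using x by auto
  qed simp
  show "?R \<subseteq> prod_space (span A) (span B)"
    by (intro span_minimal) (auto intro: prod_space_mem span_base)
qed

lemma finite_dim_power_space:
  assumes "subframe V"
  shows "\<exists>B. finite B \<and> span B = power_space V n"
proof (induction n)
  case 0
  show ?case by (intro exI[of _ "{1}"]) simp
next
  case (Suc n)
  obtain A where A: "finite A" "span A = V" using assms by (auto simp: subframe_def)
  obtain B where B: "finite B" "span B = power_space V n" using Suc by blast
  have "finite {a * b | a b. a \<in> A \<and> b \<in> B}"
    using A(1) B(1) by (rule finite_image_set2[of "\<lambda>a. a \<in> A" "\<lambda>b. b \<in> B", simplified])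
  then show ?case using finite_dim_prod_space[OF A(1) B(1)] A(2) B(2) by auto
qed

lemma dim_mono_finite:
  assumes "V \<subseteq> span B" "finite B" "W \<subseteq> V"
  shows "dim W \<le> dim V"
proof -
  obtain C where C: "C \<subseteq> W" "independent C" "W \<subseteq> span C" "card C = dim W"
    using basis_exists by blast
  obtain D where D: "D \<subseteq> V" "independent D" "V \<subseteq> span D" "card D = dim V"
    using basis_exists by blast
  have "finite D"
    using independent_span_bound[OF assms(2) D(2)] D(1) assms(1) by blast
  then have "card C \<le> card D"
    using independent_span_bound[of D C] C D assms(3) by blast
  then show ?thesis using C D by simp
qed

lemma dim_power_space_pos:
  assumes "subframe V"
  shows "dim (power_space V n) \<ge> 1"
proof -
  obtain B where B: "finite B" "span B = power_space V n"
    using finite_dim_power_space[OF assms] by blast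
  have "{1} \<subseteq> power_space V n"
    using assms one_in_power_space by (auto simp: subframe_def)
  then have "dim {1} \<le> dim (power_space V n)"
    using dim_mono_finite[of "power_space V n" B "{1}"] B by auto
  moreover have "dim {1} = 1"
    using dim_eq_card_independent[of "{1}"] by (simp add: dependent_single)
  ultimately show ?thesis by simp
qed

lemma hull_subset_Union_power_space:
  assumes "subframe W"
  shows "subalgebra hull W \<subseteq> (\<Union>n. power_space W n)"
proof (rule hull_minimal)
  have one: "1 \<in> W" using assms by (simp add: subframe_def)
  show "W \<subseteq> (\<Union>n. power_space W n)"
  proof
    fix x assume "x \<in> W"
    then have "x * 1 \<in> power_space W 1"
      using prod_space_mem[of x W 1 "span {1}"] by (auto intro: span_base)
    then show "x \<in> (\<Union>n. power_space W n)" by (metis UN_I UNIV_I mult_1_right)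
  qed
  have add: "x + y \<in> (\<Union>n. power_space W n)"
    if "x \<in> power_space W m" "y \<in> power_space W n" for x y m n
  proof -
    have "x \<in> power_space W (max m n)" "y \<in> power_space W (max m n)"
      using that power_space_mono[OF one, of m "max m n"]
        power_space_mono[OF one, of n "max m n"] by auto
    then show ?thesis using subspace_add[OF subspace_power_space] by blast
  qed
  show "subalgebra (\<Union>n. power_space W n)"
    unfolding subalgebra_def subspace_def
    using one_in_power_space[OF one] power_space_mult add
      subspace_0[OF subspace_power_space] subspace_scale[OF subspace_power_space]
    by auto blast+
qed

lemma finite_subset_power_space:
  assumes "1 \<in> W" "finite B" "B \<subseteq> (\<Union>n. power_space W n)"
  shows "\<exists>m. B \<subseteq> power_space W m"
  using assms(2,3)
proof (induction B)
  case (insert x B)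
  then obtain m n where mn: "B \<subseteq> power_space W m" "x \<in> power_space W n" by auto
  then have "insert x B \<subseteq> power_space W (max m n)"
    using power_space_mono[OF assms(1), of m "max m n"]
      power_space_mono[OF assms(1), of n "max m n"] by auto
  then show ?case by blast
qed simp

lemma growth_le:
  assumes V: "subframe V" and W: "subframe W" and VW: "V \<subseteq> subalgebra hull W"
  shows "growth V \<le> growth W"
proof -
  have oneW: "1 \<in> W" using W by (simp add: subframe_def)
  obtain B where B: "finite B" "span B = V" using V by (auto simp: subframe_def)
  have "B \<subseteq> (\<Union>n. power_space W n)"
    using B(2) VW hull_subset_Union_power_space[OF W] span_superset[of B] by blast
  then obtain m0 where "B \<subseteq> power_space W m0"
    using finite_subset_power_space[OF oneW B(1)] by blast
  then have "B \<subseteq> power_space W (Suc m0)"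
    using power_space_mono[OF oneW, of m0 "Suc m0"] by auto
  then obtain m where m: "m \<ge> 1" "V \<subseteq> power_space W m"
    using B(2) span_minimal[OF _ subspace_power_space] by (metis le_add1 plus_1_eq_Suc)
  have sub: "power_space V n \<subseteq> power_space W (m * n)" for n
  proof (induction n)
    case (Suc n)
    have "prod_space V (power_space V n) \<subseteq> power_space W (m + m * n)"
      using m(2) Suc by (intro prod_space_subset power_space_mult) auto
    then show ?case by simp
  qed simp
  have dim_le: "dim (power_space V n) \<le> dim (power_space W (m * n))" for n
  proof -
    obtain D where "finite D" "span D = power_space W (m * n)"
      using finite_dim_power_space[OF W] by blast
    then show ?thesis using dim_mono_finite[OF _ _ sub[of n], of D] by auto
  qed
  define f where "f n = ln (real (dim (power_space W n))) / ln (real n)" for n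
  define g where "g n = ln (real (dim (power_space V n))) / ln (real n)" for n
  have g_le: "g n \<le> f (m * n) * (1 + ln (real m) / ln (real n))" if n: "n \<ge> 2" for n
  proof -
    have 1: "ln (real n) > 0" using n by simp
    have 2: "ln (real (m * n)) = ln (real m) + ln (real n)"
      using m(1) n by (simp add: ln_mult)
    have 3: "ln (real (m * n)) > 0" using 1 2 m(1) by (simp add: add_nonneg_pos)
    have "ln (real (dim (power_space V n))) \<le> ln (real (dim (power_space W (m * n))))"
      using dim_le[of n] dim_power_space_pos[OF V, of n] by simp
    then have "g n \<le> ln (real (dim (power_space W (m * n)))) / ln (real n)"
      unfolding g_def using 1 by (simp add: divide_right_mono)
    also have "\<dots> = f (m * n) * (ln (real (m * n)) / ln (real n))"
      unfolding f_def using 3 by simp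
    also have "ln (real (m * n)) / ln (real n) = 1 + ln (real m) / ln (real n)"
      using 1 2 by (simp add: field_simps)
    finally show ?thesis .
  qed
  have lim: "(\<lambda>n. ln (real m) / ln (real n)) \<longlonglongrightarrow> 0"
    by (intro tendsto_divide_0[OF tendsto_const] filterlim_at_top_imp_at_infinity
        filterlim_compose[OF ln_at_top filterlim_real_sequentially])
  have "limsup (\<lambda>n. ennreal (g n)) \<le> limsup (\<lambda>n. ennreal (f n))"
  proof (rule dense_ge)
    fix c assume c: "limsup (\<lambda>n. ennreal (f n)) < c"
    obtain b where b: "limsup (\<lambda>n. ennreal (f n)) < b" "b < c" using dense[OF c] by blast
    show "limsup (\<lambda>n. ennreal (g n)) \<le> c"
    proof (cases c)
      case (real c')
      obtain b' where b': "b = ennreal b'" "b' \<ge> 0"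
        using b(2) by (cases b) auto
      have bc: "b' < c'" using b(2) b' real by (simp add: ennreal_less_iff)
      have bpos: "b' > 0" using b(1) b' by (cases "b' = 0") auto
      have "eventually (\<lambda>n. ennreal (f n) < b) sequentially"
        using b(1) by (rule Limsup_lessD)
      then obtain N where N: "\<And>n. n \<ge> N \<Longrightarrow> ennreal (f n) < b"
        unfolding eventually_sequentially by blast
      have "(\<lambda>n. b' * (1 + ln (real m) / ln (real n))) \<longlonglongrightarrow> b' * (1 + 0)"
        by (intro tendsto_intros lim)
      then have ev: "eventually (\<lambda>n. b' * (1 + ln (real m) / ln (real n)) < c') sequentially"
        using bc by (auto dest: order_tendstoD(2))
      have "eventually (\<lambda>n. ennreal (g n) \<le> c) sequentially"
        using ev eventually_ge_at_top[of "max 2 N"]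
      proof eventually_elim
        case (elim n)
        have "m * n \<ge> N"
          using elim(2) m(1) by (metis le_trans max.bounded_iff mult_le_mono1 nat_mult_1)
        then have "ennreal (f (m * n)) < ennreal b'" using N b'(1) by blast
        then have "f (m * n) < b'" by (metis ennreal_leI linorder_not_less)
        moreover have "0 \<le> 1 + ln (real m) / ln (real n)"
          using elim(2) m(1) by (intro add_nonneg_nonneg divide_nonneg_nonneg) auto
        ultimately have "g n \<le> b' * (1 + ln (real m) / ln (real n))"
          using g_le[of n] elim(2)
          by (meson less_imp_le max.bounded_iff mult_right_mono order_trans)
        then show ?case using elim(1) real by (simp add: ennreal_leI)
      qed
      then show ?thesis by (rule Limsup_bounded)
    qed simp
  qed
  then show ?thesis by (simp add: growth_def f_def g_def)
qed

lemma GKdim_fg_eq: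
  assumes V: "subframe V" "subalgebra hull V = B"
  shows "GKdim_fg B = growth V"
proof -
  let ?U = "SOME V. subframe V \<and> subalgebra hull V = B"
  have U: "subframe ?U \<and> subalgebra hull ?U = B"
    using V by (intro someI[of "\<lambda>V. subframe V \<and> subalgebra hull V = B"]) simp
  have "?U \<subseteq> B" "V \<subseteq> B"
    using U V(2) hull_subset[of _ subalgebra] by metis+
  then have "growth ?U = growth V"
    using U V by (intro antisym growth_le) auto
  then show ?thesis by (simp add: GKdim_fg_def)
qed

end

end

theory Submission
  imports Defs
begin

text \<open>
  Let \<open>V\<close> be a subframe and let \<open>d > 0\<close> be an exponent that is admissible in the definition of
  \<open>VDI_star V\<close>, with constant \<open>C\<close>. The isoperimetric inequality is applied to the powers
  \<open>W = V\<^sup>n\<close> only: both \<open>V V\<^sup>n\<close> and \<open>V\<^sup>n V\<close> lie in \<open>V\<^bsup>n+1\<^esup>\<close>, so the dimensions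
  \<open>f n = dim V\<^sup>n\<close> satisfy the difference inequality
  \<open>f (n + 1) \<ge> f n + C (f n)\<^bsup>(d-1)/d\<^esup>\<close>.
  Its continuous analogue \<open>y' = C y\<^bsup>(d-1)/d\<^esup>\<close> has the solutions \<open>y\<close> with \<open>y\<^bsup>1/d\<^esup>\<close> affine in
  time, so \<open>f\<close> should grow at least like a multiple of \<open>n\<^sup>d\<close>; this is proved for \<open>d \<ge> 1\<close> in
  \<open>power_growth_of_difference_inequality\<close>. For \<open>d \<le> 1\<close> the inequality still says that \<open>f\<close>
  increases strictly, and as \<open>f\<close> takes integer values, \<open>f n \<ge> n \<ge> n\<^sup>d\<close>. In both cases the
  growth exponent of \<open>V\<close> is at least \<open>d\<close>, and it is the Gelfand-Kirillov dimension of the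
  subalgebra generated by \<open>V\<close>.
\<close>

text \<open>
  This is the mean value theorem for \<open>t\<^sup>d\<close>, whose derivative is increasing because \<open>d \<ge> 1\<close>.
\<close>

lemma powr_diff_le:
  fixes x y d :: real
  assumes "0 < x" "x < y" "1 \<le> d"
  shows "y powr d - x powr d \<le> (y - x) * (d * y powr (d - 1))"
proof -
  have "\<exists>z. x < z \<and> z < y \<and> y powr d - x powr d = (y - x) * (d * z powr (d - 1))"
    using assms by (intro MVT2) (auto intro!: has_real_derivative_powr)
  then obtain z where z: "x < z" "z < y"
    "y powr d - x powr d = (y - x) * (d * z powr (d - 1))" by blast
  have "z powr (d - 1) \<le> y powr (d - 1)"
    using z assms by (intro powr_mono2) auto
  then show ?thesis
    using z(3) assms by (simp add: mult_left_mono)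
qed

text \<open>
  The comparison function \<open>(b n)\<^sup>d\<close> increases by at most \<open>d b (b (n + 1))\<^bsup>d-1\<^esup>\<close> from \<open>n\<close> to
  \<open>n + 1\<close>, hence by at most \<open>d b 2\<^bsup>d-1\<^esup> (b n)\<^bsup>d-1\<^esup>\<close>. Once \<open>b\<close> is so small that
  \<open>d b 2\<^bsup>d-1\<^esup> \<le> C\<close>, this is no more than the increase that is forced upon \<open>f\<close>.
  The factor \<open>2\<close> comes from \<open>n + 1 \<le> 2 n\<close>, which needs \<open>n \<ge> 1\<close>; so the induction starts at
  \<open>n = 1\<close>, and there it needs \<open>b \<le> 1\<close>.
\<close>

lemma power_growth_of_difference_inequality:
  fixes f :: "nat \<Rightarrow> real" and C d :: real
  assumes d: "1 \<le> d" and C: "0 < C" and f1: "1 \<le> f 1"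
    and diff: "\<And>n. f n + C * f n powr ((d - 1) / d) \<le> f (Suc n)"
  shows "\<exists>b>0. \<forall>n\<ge>1. (b * real n) powr d \<le> f n"
proof -
  define b where "b = min 1 (C / (d * 2 powr (d - 1)))"
  have b: "0 < b" "b \<le> 1" using C d by (auto simp: b_def)
  have "b \<le> C / (d * 2 powr (d - 1))" by (simp add: b_def)
  then have bC: "b * (d * 2 powr (d - 1)) \<le> C"
    using d by (simp add: pos_le_divide_eq)
  have "(b * real n) powr d \<le> f n" if "n \<ge> 1" for n
    using that
  proof (induction n rule: dec_induct)
    case base
    have "b powr d \<le> 1" using b d by (simp add: powr_le1)
    then show ?case using f1 by simp
  next
    case (step n)
    define x where "x = b * real n"
    have x: "0 < x" using b step.hyps by (simp add: x_def)
    have y: "b * real (Suc n) = x + b" by (simp add: x_def algebra_simps)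
    have "b \<le> x" using b step.hyps by (simp add: x_def)
    then have "(x + b) powr (d - 1) \<le> (2 * x) powr (d - 1)"
      using b x d by (intro powr_mono2) auto
    also have "\<dots> = 2 powr (d - 1) * x powr (d - 1)"
      using x by (simp add: powr_mult)
    finally have "b * (d * (x + b) powr (d - 1)) \<le> b * (d * (2 powr (d - 1) * x powr (d - 1)))"
      using b d by (simp add: mult_left_mono)
    also have "\<dots> = (b * (d * 2 powr (d - 1))) * x powr (d - 1)"
      by (simp add: mult_ac)
    also have "\<dots> \<le> C * x powr (d - 1)"
      using bC by (intro mult_right_mono) auto
    finally have 1: "(x + b) powr d \<le> x powr d + C * x powr (d - 1)"
      using powr_diff_le[of x "x + b" d] x b d by simp
    have IH: "x powr d \<le> f n" using step.IH by (simp add: x_def)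
    have "x powr (d - 1) = (x powr d) powr ((d - 1) / d)"
      using d by (simp add: powr_powr)
    also have "\<dots> \<le> f n powr ((d - 1) / d)"
      using IH d by (intro powr_mono2) auto
    finally have "C * x powr (d - 1) \<le> C * f n powr ((d - 1) / d)"
      using C by (simp add: mult_left_mono)
    with 1 IH diff[of n] show ?case unfolding y by linarith
  qed
  with b(1) show ?thesis by blast
qed

text \<open>
  The constant \<open>b\<close> disappears in the limit, because it contributes only \<open>d ln b / ln n\<close>.
\<close>

lemma limsup_log_ratio_ge:
  fixes f :: "nat \<Rightarrow> real" and b d :: real
  assumes b: "0 < b" and f: "\<And>n. n \<ge> 1 \<Longrightarrow> (b * real n) powr d \<le> f n"
  shows "ennreal d \<le> limsup (\<lambda>n. ennreal (ln (f n) / ln (real n)))"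
proof -
  have "(\<lambda>n. d * (ln b / ln (real n) + 1)) \<longlonglongrightarrow> d * (0 + 1)"
    by (intro tendsto_intros tendsto_divide_0[OF tendsto_const]
        filterlim_at_top_imp_at_infinity
        filterlim_compose[OF ln_at_top filterlim_real_sequentially])
  then have lim: "(\<lambda>n. ennreal (d * (ln b / ln (real n) + 1))) \<longlonglongrightarrow> ennreal d"
    by (intro tendsto_ennrealI) simp
  have "eventually (\<lambda>n. ennreal (d * (ln b / ln (real n) + 1))
          \<le> ennreal (ln (f n) / ln (real n))) sequentially"
    using eventually_ge_at_top[of 2]
  proof eventually_elim
    case (elim n)
    have n: "ln (real n) > 0" using elim by simp
    have pos: "0 < (b * real n) powr d" using b elim by simp
    have "d * (ln b + ln (real n)) = ln ((b * real n) powr d)"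
      using b elim by (simp add: ln_powr ln_mult)
    also have "\<dots> \<le> ln (f n)"
      using f[of n] pos elim by (intro ln_mono) auto
    finally have "d * (ln b + ln (real n)) / ln (real n) \<le> ln (f n) / ln (real n)"
      using n by (intro divide_right_mono) auto
    moreover have "d * (ln b + ln (real n)) / ln (real n) = d * (ln b / ln (real n) + 1)"
      using n by (simp add: add_divide_distrib distrib_left)
    ultimately have "d * (ln b / ln (real n) + 1) \<le> ln (f n) / ln (real n)" by simp
    then show ?case by (rule ennreal_leI)
  qed
  then have "limsup (\<lambda>n. ennreal (d * (ln b / ln (real n) + 1)))
      \<le> limsup (\<lambda>n. ennreal (ln (f n) / ln (real n)))"
    by (rule Limsup_mono)
  with lim show ?thesis
    by (simp add: lim_imp_Limsup)
qed

context k_algebra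
begin

lemma subframe_power_space:
  assumes "subframe V"
  shows "subframe (power_space V n)"
  using assms finite_dim_power_space[OF assms] one_in_power_space
  unfolding subframe_def by auto

lemma prod_space_power_space_right:
  "prod_space (power_space V n) V \<subseteq> power_space V (Suc n)"
proof (rule prod_space_subset)
  fix x v assume x: "x \<in> power_space V n" and v: "v \<in> V"
  have "v * 1 \<in> power_space V 1"
    using prod_space_mem[of v V 1 "span {1}"] v by (auto intro: span_base)
  then show "x * v \<in> power_space V (Suc n)"
    using power_space_mult[OF x, of v 1] by simp
qed simp

lemma max_dim_prod_power_space_le:
  assumes V: "subframe V"
  shows "max (dim (prod_space V (power_space V n))) (dim (prod_space (power_space V n) V))
    \<le> dim (power_space V (Suc n))"
proof -
  obtain D where D: "finite D" "span D = power_space V (Suc n)"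
    using finite_dim_power_space[OF V] by blast
  have "dim (prod_space (power_space V n) V) \<le> dim (power_space V (Suc n))"
    using D prod_space_power_space_right by (intro dim_mono_finite[of _ D]) auto
  then show ?thesis by simp
qed

text \<open>
  Every admissible exponent is a lower bound of the growth exponent, since the inequality in
  \<open>VDI_star V\<close> may be tested on the powers of \<open>V\<close>. For \<open>d < 1\<close> the increment
  \<open>C (f n)\<^bsup>(d-1)/d\<^esup>\<close> may tend to \<open>0\<close>, and only its positivity is used.
\<close>

lemma VDI_star_le_growth:
  assumes V: "subframe V"
  shows "VDI_star V \<le> growth V"
  unfolding VDI_star_def
proof (rule Sup_least, clarify)
  fix d C :: real
  assume d: "0 < d" and C: "0 < C"
    and iso: "\<forall>W. subframe W \<longrightarrow>
        real (dim W) + C * real (dim W) powr ((d - 1) / d)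
          \<le> real (max (dim (prod_space V W)) (dim (prod_space W V)))"
  define f where "f n = dim (power_space V n)" for n
  have f1: "f n \<ge> 1" for n
    using dim_power_space_pos[OF V] by (simp add: f_def)
  have step: "real (f n) + C * real (f n) powr ((d - 1) / d) \<le> real (f (Suc n))" for n
  proof -
    have "real (max (dim (prod_space V (power_space V n))) (dim (prod_space (power_space V n) V)))
        \<le> real (f (Suc n))"
      unfolding f_def using max_dim_prod_power_space_le[OF V] by (rule of_nat_mono)
    then show ?thesis
      using iso subframe_power_space[OF V, of n] unfolding f_def by (meson order_trans)
  qed
  have "\<exists>b>0. \<forall>n\<ge>1. (b * real n) powr d \<le> real (f n)"
  proof (cases "d \<ge> 1")
    case True
    show ?thesis
      using power_growth_of_difference_inequality[of d C "\<lambda>n. real (f n)"] True C f1[of 1] step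
      by simp
  next
    case False
    have "f n < f (Suc n)" for n
    proof -
      have "0 < C * real (f n) powr ((d - 1) / d)"
        using C f1[of n] by simp
      then show ?thesis using step[of n] by linarith
    qed
    then have "strict_mono f" by (simp add: strict_mono_Suc_iff)
    then have n_le: "n \<le> f n" for n by (rule strict_mono_imp_increasing)
    have "(1 * real n) powr d \<le> real (f n)" if "n \<ge> 1" for n
    proof -
      have "real n powr d \<le> real n powr 1"
        using False that by (intro powr_mono) auto
      then show ?thesis using n_le[of n] that by simp
    qed
    then show ?thesis by (intro exI[of _ 1]) simp
  qed
  then obtain b where b: "b > 0" "\<And>n. n \<ge> 1 \<Longrightarrow> (b * real n) powr d \<le> real (f n)" by blast
  show "ennreal d \<le> growth V"
    unfolding growth_def using limsup_log_ratio_ge[of b d "\<lambda>n. real (f n)", OF b]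
    by (simp add: f_def)
qed

lemma fin_gen_subalgebra_hull_subframe:
  assumes "subframe V"
  shows "fin_gen_subalgebra (subalgebra hull V)"
proof -
  obtain B where B: "finite B" "span B = V" using assms by (auto simp: subframe_def)
  have "V \<subseteq> subalgebra hull B"
    using B(2) subalgebra_hull[of B] hull_subset[of B subalgebra]
      span_minimal[of B "subalgebra hull B"]
    by (auto simp: subalgebra_def)
  then have "subalgebra hull V \<subseteq> subalgebra hull B"
    by (rule hull_minimal) (rule subalgebra_hull)
  moreover have "subalgebra hull B \<subseteq> subalgebra hull V"
    using B(2) span_superset[of B] by (intro hull_mono) simp
  ultimately show ?thesis
    using B(1) unfolding fin_gen_subalgebra_def by blast
qed

lemma growth_le_GKdim:
  assumes "subframe V"
  shows "growth V \<le> GKdim"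
proof -
  have "growth V = GKdim_fg (subalgebra hull V)"
    using assms GKdim_fg_eq by simp
  also have "\<dots> \<le> GKdim"
    unfolding GKdim_def using fin_gen_subalgebra_hull_subframe[OF assms]
    by (intro SUP_upper) simp
  finally show ?thesis .
qed

lemma Ld_star_le_GKdim: "Ld_star \<le> GKdim"
  unfolding Ld_star_def
  by (rule SUP_least) (auto intro: order_trans[OF VDI_star_le_growth growth_le_GKdim])

end

theorem proposition3p1:
  fixes scale :: "'k::field \<Rightarrow> 'a::ring_1_no_zero_divisors \<Rightarrow> 'a"
  assumes "k_algebra scale"
  shows "k_algebra.Ld_star scale \<le> k_algebra.GKdim scale"
  using assms by (rule k_algebra.Ld_star_le_GKdim)

end
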